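(* For every closed term $M$ and every value $V$: if $M\to_{a\cup\beta}^{*} V$, then $(\overline{M})~\lambda x\,x\to_{\ell\cup\beta}^{*}\Phi(V)$.
   Context: Fix a ring of scalars (elements $\alpha,\beta$). Terms, values and base terms are given by: $M,N,L ::= V \mid (M)~N \mid \alpha.M \mid M+N$ (terms); $U,V,W ::= 0 \mid B \mid \alpha.V \mid V+W$ (values); $B ::= x \mid \lambda x\,M$ (base terms). Terms are taken up to renaming of bound variables; $M[x:=N]$ is capture-avoiding substitution. Below $V$ is a value and $B$ a base term. Rewrite rules: $(\beta_n)$ $(\lambda x\,M)~N\to M[x:=N]$. $(A)$ $(M+N)~L\to (M)~L+(N)~L$; $(\alpha.M)~N\to\alpha.(M)~N$; $(0)~M\to 0$. $(\beta_v)$ $(\lambda x\,M)~B\to M[x:=B]$. $(A_l)$ $(M+N)~V\to(M)~V+(N)~V$; $(\alpha.M)~V\to\alpha.(M)~V$; $(0)~V\to 0$. $(A_r)$ $(B)~(M+N)\to(B)~M+(B)~N$; $(B)~(\alpha.M)\to\alpha.(B)~M$; $(B)~0\to 0$. (Asso) $M+(N+L)\to(M+N)+L$ and $(M+N)+L\to M+(N+L)$. (Com) $M+N\to N+M$. $(F)$ $\alpha.M+\beta.M\to(\alpha+\beta).M$; $\alpha.M+M\to(\alpha+1).M$; $M+M\to(1+1).M$; $\alpha.(\beta.M)\to(\alpha\beta).M$. $(S)$ $\alpha.(M+N)\to\alpha.M+\alpha.N$; $1.M\to M$; $0.M\to 0$; $\alpha.0\to 0$; $0+M\to M$. Context rules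 $(\xi)$: from $M\to M'$ infer $(M)~N\to(M')~N$, $M+N\to M'+N$, $N+M\to N+M'$, $\alpha.M\to\alpha.M'$. Context rule $(\xi_{lin})$: from $M\to M'$ infer $(V)~M\to(V)~M'$ for $V$ a value. Let $L=\mathrm{Asso}\cup\mathrm{Com}\cup F\cup S$. Define: $\to_a$ generated by $A\cup L$ closed under $\xi$; $\to_\ell$ generated by $A_l\cup A_r\cup L$ closed under $\xi,\xi_{lin}$; $\to_{\beta_v}$ generated by $\beta_v$ closed under $\xi,\xi_{lin}$; $\to_{\beta_n}$ generated by $\beta_n$ closed under $\xi$. $R^{*}$ denotes reflexive-transitive closure. Set $\to_{\ell\cup\beta}:=\to_\ell\cup\to_{\beta_v}$ and $\to_{a\cup\beta}:=\to_a\cup\to_{\beta_n}$. Translation (with $f,g,y$ fresh variables): $\overline{x}=x$; $\overline{0}=\lambda f\,(0)~f$; $\overline{\lambda x\,M}=\lambda f\,(f)~\lambda x\,\overline M$; $\overline{(M)~N}=\lambda f\,(\overline M)~\lambda g\,((g)~\overline N)~f$; $\overline{\alpha.M}=\lambda f\,(\alpha.\overline M)~f$; $\overline{M+N}=\lambda f\,(\overline M+\overline N)~f$. On values: $\Phi(x)=(x)~\lambda y\,y$, $\Phi(0)=0$, $\Phi(\lambda x\,M)=\lambda x\,\overline M$, $\Phi(\alpha.V)=\alpha.\Phi(V)$, $\Phi(V+W)=\Phi(V)+\Phi(W)$. *)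

theory Defs
  imports Main
begin

text \<open>
  The algebraic lambda-calculus. Terms up to renaming of bound variables are represented with
  de Bruijn indices; free variables are the indices that exceed the number of enclosing
  abstractions. The type parameter is the type of scalars. The sort \<open>{ring, monoid_mult}\<close>
  used below is that of unital rings, not necessarily commutative; unlike \<open>ring_1\<close> it does not
  require \<open>0 \<noteq> 1\<close>.
\<close>

datatype 'a trm =
    Var nat
  | Lam "'a trm"
  | App "'a trm" "'a trm"
  | Zero
  | Scale 'a "'a trm"
  | Plus "'a trm" "'a trm"

inductive is_base :: "'a trm \<Rightarrow> bool" where
  "is_base (Var i)"
| "is_base (Lam M)"

inductive is_value :: "'a trm \<Rightarrow> bool" where
  "is_value Zero"
| "is_base B \<Longrightarrow> is_value B"
| "is_value V \<Longrightarrow> is_value (Scale \<alpha> V)"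
| "is_value V \<Longrightarrow> is_value W \<Longrightarrow> is_value (Plus V W)"

primrec free_vars :: "'a trm \<Rightarrow> nat set" where
  "free_vars (Var i) = {i}"
| "free_vars (Lam M) = {i. Suc i \<in> free_vars M}"
| "free_vars (App M N) = free_vars M \<union> free_vars N"
| "free_vars Zero = {}"
| "free_vars (Scale \<alpha> M) = free_vars M"
| "free_vars (Plus M N) = free_vars M \<union> free_vars N"

definition closed_term :: "'a trm \<Rightarrow> bool" where
  "closed_term M \<longleftrightarrow> free_vars M = {}"

text \<open>\<open>lift M k\<close> increments the indices \<open>\<ge> k\<close>, i.e. places \<open>M\<close> under one further (fresh) binder.\<close>

primrec lift :: "'a trm \<Rightarrow> nat \<Rightarrow> 'a trm" where
  "lift (Var i) k = (if i < k then Var i else Var (Suc i))"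
| "lift (Lam M) k = Lam (lift M (Suc k))"
| "lift (App M N) k = App (lift M k) (lift N k)"
| "lift Zero k = Zero"
| "lift (Scale \<alpha> M) k = Scale \<alpha> (lift M k)"
| "lift (Plus M N) k = Plus (lift M k) (lift N k)"

text \<open>
  \<open>subst M N k\<close> replaces index \<open>k\<close> by \<open>N\<close> and decrements the larger indices, since the binder of
  \<open>k\<close> disappears; for \<open>Lam M\<close> binding \<open>x\<close>, the term \<open>M[x:=N]\<close> is \<open>subst M N 0\<close>.
\<close>

primrec subst :: "'a trm \<Rightarrow> 'a trm \<Rightarrow> nat \<Rightarrow> 'a trm" where
  "subst (Var i) N k = (if k < i then Var (i - 1) else if i = k then N else Var i)"
| "subst (Lam M) N k = Lam (subst M (lift N 0) (Suc k))"
| "subst (App M L) N k = App (subst M N k) (subst L N k)"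
| "subst Zero N k = Zero"
| "subst (Scale \<alpha> M) N k = Scale \<alpha> (subst M N k)"
| "subst (Plus M L) N k = Plus (subst M N k) (subst L N k)"

inductive rule_beta_n :: "'a trm \<Rightarrow> 'a trm \<Rightarrow> bool" where
  "rule_beta_n (App (Lam M) N) (subst M N 0)"

inductive rule_beta_v :: "'a trm \<Rightarrow> 'a trm \<Rightarrow> bool" where
  "is_base B \<Longrightarrow> rule_beta_v (App (Lam M) B) (subst M B 0)"

inductive rule_A :: "'a trm \<Rightarrow> 'a trm \<Rightarrow> bool" where
  "rule_A (App (Plus M N) L) (Plus (App M L) (App N L))"
| "rule_A (App (Scale \<alpha> M) N) (Scale \<alpha> (App M N))"
| "rule_A (App Zero M) Zero"

inductive rule_Al :: "'a trm \<Rightarrow> 'a trm \<Rightarrow> bool" where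
  "is_value V \<Longrightarrow> rule_Al (App (Plus M N) V) (Plus (App M V) (App N V))"
| "is_value V \<Longrightarrow> rule_Al (App (Scale \<alpha> M) V) (Scale \<alpha> (App M V))"
| "is_value V \<Longrightarrow> rule_Al (App Zero V) Zero"

inductive rule_Ar :: "'a trm \<Rightarrow> 'a trm \<Rightarrow> bool" where
  "is_base B \<Longrightarrow> rule_Ar (App B (Plus M N)) (Plus (App B M) (App B N))"
| "is_base B \<Longrightarrow> rule_Ar (App B (Scale \<alpha> M)) (Scale \<alpha> (App B M))"
| "is_base B \<Longrightarrow> rule_Ar (App B Zero) Zero"

inductive rule_Asso :: "'a trm \<Rightarrow> 'a trm \<Rightarrow> bool" where
  "rule_Asso (Plus M (Plus N L)) (Plus (Plus M N) L)"
| "rule_Asso (Plus (Plus M N) L) (Plus M (Plus N L))"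

inductive rule_Com :: "'a trm \<Rightarrow> 'a trm \<Rightarrow> bool" where
  "rule_Com (Plus M N) (Plus N M)"

inductive rule_F :: "'a::{ring, monoid_mult} trm \<Rightarrow> 'a trm \<Rightarrow> bool" where
  "rule_F (Plus (Scale \<alpha> M) (Scale \<beta> M)) (Scale (\<alpha> + \<beta>) M)"
| "rule_F (Plus (Scale \<alpha> M) M) (Scale (\<alpha> + 1) M)"
| "rule_F (Plus M M) (Scale (1 + 1) M)"
| "rule_F (Scale \<alpha> (Scale \<beta> M)) (Scale (\<alpha> * \<beta>) M)"

inductive rule_S :: "'a::{ring, monoid_mult} trm \<Rightarrow> 'a trm \<Rightarrow> bool" where
  "rule_S (Scale \<alpha> (Plus M N)) (Plus (Scale \<alpha> M) (Scale \<alpha> N))"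
| "rule_S (Scale 1 M) M"
| "rule_S (Scale 0 M) Zero"
| "rule_S (Scale \<alpha> Zero) Zero"
| "rule_S (Plus Zero M) M"

definition rule_L :: "'a::{ring, monoid_mult} trm \<Rightarrow> 'a trm \<Rightarrow> bool" where
  "rule_L = sup rule_Asso (sup rule_Com (sup rule_F rule_S))"

inductive ctx_xi :: "('a trm \<Rightarrow> 'a trm \<Rightarrow> bool) \<Rightarrow> 'a trm \<Rightarrow> 'a trm \<Rightarrow> bool"
  for R where
  "R M M' \<Longrightarrow> ctx_xi R M M'"
| "ctx_xi R M M' \<Longrightarrow> ctx_xi R (App M N) (App M' N)"
| "ctx_xi R M M' \<Longrightarrow> ctx_xi R (Plus M N) (Plus M' N)"
| "ctx_xi R M M' \<Longrightarrow> ctx_xi R (Plus N M) (Plus N M')"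
| "ctx_xi R M M' \<Longrightarrow> ctx_xi R (Scale \<alpha> M) (Scale \<alpha> M')"

inductive ctx_xi_lin :: "('a trm \<Rightarrow> 'a trm \<Rightarrow> bool) \<Rightarrow> 'a trm \<Rightarrow> 'a trm \<Rightarrow> bool"
  for R where
  "R M M' \<Longrightarrow> ctx_xi_lin R M M'"
| "ctx_xi_lin R M M' \<Longrightarrow> ctx_xi_lin R (App M N) (App M' N)"
| "ctx_xi_lin R M M' \<Longrightarrow> ctx_xi_lin R (Plus M N) (Plus M' N)"
| "ctx_xi_lin R M M' \<Longrightarrow> ctx_xi_lin R (Plus N M) (Plus N M')"
| "ctx_xi_lin R M M' \<Longrightarrow> ctx_xi_lin R (Scale \<alpha> M) (Scale \<alpha> M')"
| "is_value V \<Longrightarrow> ctx_xi_lin R M M' \<Longrightarrow> ctx_xi_lin R (App V M) (App V M')"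

definition step_a :: "'a::{ring, monoid_mult} trm \<Rightarrow> 'a trm \<Rightarrow> bool" where
  "step_a = ctx_xi (sup rule_A rule_L)"

definition step_l :: "'a::{ring, monoid_mult} trm \<Rightarrow> 'a trm \<Rightarrow> bool" where
  "step_l = ctx_xi_lin (sup rule_Al (sup rule_Ar rule_L))"

definition step_beta_n :: "'a trm \<Rightarrow> 'a trm \<Rightarrow> bool" where
  "step_beta_n = ctx_xi rule_beta_n"

definition step_beta_v :: "'a trm \<Rightarrow> 'a trm \<Rightarrow> bool" where
  "step_beta_v = ctx_xi_lin rule_beta_v"

definition step_a_beta :: "'a::{ring, monoid_mult} trm \<Rightarrow> 'a trm \<Rightarrow> bool" where
  "step_a_beta = sup step_a step_beta_n"

definition step_l_beta :: "'a::{ring, monoid_mult} trm \<Rightarrow> 'a trm \<Rightarrow> bool" where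
  "step_l_beta = sup step_l step_beta_v"

text \<open>
  The continuation-passing translation. Freshness of the variables \<open>f\<close> and \<open>g\<close> is expressed by
  lifting the translated subterms over their binders: in the clause for \<open>Lam\<close>, the binder \<open>f\<close> is
  inserted outside the binder \<open>x\<close> (hence the lift at 1); in the clause for \<open>App\<close>, under \<open>g\<close>
  the index 0 is \<open>g\<close> and 1 is \<open>f\<close>.
\<close>

primrec cps :: "'a trm \<Rightarrow> 'a trm" where
  "cps (Var i) = Var i"
| "cps Zero = Lam (App Zero (Var 0))"
| "cps (Lam M) = Lam (App (Var 0) (Lam (lift (cps M) 1)))"
| "cps (App M N) =
     Lam (App (lift (cps M) 0) (Lam (App (App (Var 0) (lift (lift (cps N) 0) 0)) (Var 1))))"
| "cps (Scale \<alpha> M) = Lam (App (Scale \<alpha> (lift (cps M) 0)) (Var 0))"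
| "cps (Plus M N) = Lam (App (Plus (lift (cps M) 0) (lift (cps N) 0)) (Var 0))"

text \<open>\<open>Phi\<close> is only meaningful on values, so there is no clause for \<open>App\<close>.\<close>

primrec (nonexhaustive) Phi :: "'a trm \<Rightarrow> 'a trm" where
  "Phi (Var i) = App (Var i) (Lam (Var 0))"
| "Phi Zero = Zero"
| "Phi (Lam M) = Lam (cps M)"
| "Phi (Scale \<alpha> V) = Scale \<alpha> (Phi V)"
| "Phi (Plus V W) = Plus (Phi V) (Phi W)"

end

theory Submission
  imports Defs
begin

text \<open>
  The term \<open>(cps M) K\<close> first performs administrative steps. Their result is the colon translation
  \<open>M : K\<close>, which pushes the continuation \<open>K\<close> through sums and scalars down to the base terms
  in head position. For a base term \<open>K\<close>, every call-by-name step from \<open>M\<close> is simulated on \<open>M : K\<close>: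
  the rules \<open>A\<close> become identities, the rules \<open>L\<close> are preserved, and a \<open>\<beta>\<^sub>n\<close>-step
  becomes two \<open>\<beta>\<^sub>v\<close>-steps followed by administrative steps, since \<open>cps N\<close> is always a base
  term. Finally \<open>V : \<lambda>x. x\<close> reduces to \<open>\<Phi> V\<close>.
\<close>

lemma lift_lift: "i \<le> k \<Longrightarrow> lift (lift M i) (Suc k) = lift (lift M k) i"
  by (induction M arbitrary: i k) auto

text \<open>Index \<open>k\<close> does not occur in \<open>lift M k\<close>. This is how the lifts
  encoding freshness in \<open>cps\<close> cancel once a continuation is substituted for f.\<close>

lemma subst_lift_same [simp]: "subst (lift M k) N k = M"
  by (induction M arbitrary: N k) auto

lemma subst_lift:
  "i \<le> k \<Longrightarrow> subst (lift M i) (lift N i) (Suc k) = lift (subst M N k) i"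
proof (induction M arbitrary: N i k)
  case (Lam M)
  have "lift (lift N i) 0 = lift (lift N 0) (Suc i)"
    by (simp add: lift_lift)
  with Lam show ?case by simp
qed auto

lemma cps_lift: "cps (lift M k) = lift (cps M) k"
  by (induction M arbitrary: k) (auto simp: lift_lift)

text \<open>Holds as an equality, with no administrative steps, because \<open>cps\<close> sends a
  variable to itself.\<close>

lemma cps_subst: "cps (subst M N k) = subst (cps M) (cps N) k"
proof (induction M arbitrary: N k)
  case (Lam M)
  \<comment> \<open>Two binders, f and x, are crossed. The lift for f has cutoff 1, so
    \<open>subst_lift\<close> applies once the outer lift of \<open>cps N\<close> is moved from 0 to
    1.\<close>
  have "subst (lift (cps M) (Suc 0)) (lift (lift (cps N) 0) 0) (Suc (Suc k))
      = lift (subst (cps M) (lift (cps N) 0) (Suc k)) (Suc 0)"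
    using subst_lift [of "Suc 0" "Suc k" "cps M" "lift (cps N) 0"]
    by (simp add: lift_lift)
  with Lam show ?case by (simp add: cps_lift)
qed (auto simp: subst_lift)

lemma is_base_cps [simp]: "is_base (cps M)"
  by (cases M) (auto intro: is_base.intros)

text \<open>The \<open>App\<close> clause shows the continuation after K has replaced f: only the
  binder g remains, hence single lifts.\<close>

primrec colon :: "'a trm \<Rightarrow> 'a trm \<Rightarrow> 'a trm" where
  "colon (Var i) K = App (Var i) K"
| "colon (Lam M) K = App K (Lam (cps M))"
| "colon (App M N) K = colon M (Lam (App (App (Var 0) (lift (cps N) 0)) (lift K 0)))"
| "colon Zero K = Zero"
| "colon (Scale \<alpha> M) K = Scale \<alpha> (colon M K)"
| "colon (Plus M N) K = Plus (colon M K) (colon N K)"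

lemma ctx_xi_lin_rtranclp_Plus:
  assumes "(ctx_xi_lin R)\<^sup>*\<^sup>* M M'" and "(ctx_xi_lin R)\<^sup>*\<^sup>* N N'"
  shows "(ctx_xi_lin R)\<^sup>*\<^sup>* (Plus M N) (Plus M' N')"
proof -
  from assms(1) have "(ctx_xi_lin R)\<^sup>*\<^sup>* (Plus M N) (Plus M' N)"
    by induction (auto intro: rtranclp.rtrancl_into_rtrancl ctx_xi_lin.intros(3))
  also from assms(2) have "(ctx_xi_lin R)\<^sup>*\<^sup>* (Plus M' N) (Plus M' N')"
    by induction (auto intro: rtranclp.rtrancl_into_rtrancl ctx_xi_lin.intros(4))
  finally show ?thesis .
qed

lemma ctx_xi_lin_rtranclp_Scale:
  assumes "(ctx_xi_lin R)\<^sup>*\<^sup>* M M'"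
  shows "(ctx_xi_lin R)\<^sup>*\<^sup>* (Scale \<alpha> M) (Scale \<alpha> M')"
  using assms by induction (auto intro: rtranclp.rtrancl_into_rtrancl ctx_xi_lin.intros(5))

text \<open>Each context rule has one reducing premise, so closure commutes with union. Thus the
  congruence lemmas cover sequences mixing both kinds of step.\<close>

lemma ctx_xi_lin_sup:
  "sup (ctx_xi_lin R) (ctx_xi_lin S) = ctx_xi_lin (sup R S)"
proof (intro antisym le_supI predicate2I)
  fix M N
  show "ctx_xi_lin (sup R S) M N" if "ctx_xi_lin R M N"
    using that by induction (auto intro: ctx_xi_lin.intros)
  show "ctx_xi_lin (sup R S) M N" if "ctx_xi_lin S M N"
    using that by induction (auto intro: ctx_xi_lin.intros)
  show "sup (ctx_xi_lin R) (ctx_xi_lin S) M N" if "ctx_xi_lin (sup R S) M N"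
    using that by induction (auto intro: ctx_xi_lin.intros)
qed

lemma step_l_beta_eq:
  "step_l_beta = ctx_xi_lin (sup (sup rule_Al (sup rule_Ar rule_L)) rule_beta_v)"
  unfolding step_l_beta_def step_l_def step_beta_v_def by (rule ctx_xi_lin_sup)

lemmas step_l_beta_rtranclp_Plus =
  ctx_xi_lin_rtranclp_Plus [where R = "sup (sup rule_Al (sup rule_Ar rule_L)) rule_beta_v",
    folded step_l_beta_eq]

lemmas step_l_beta_rtranclp_Scale =
  ctx_xi_lin_rtranclp_Scale [where R = "sup (sup rule_Al (sup rule_Ar rule_L)) rule_beta_v",
    folded step_l_beta_eq]

lemma step_l_beta_beta_v: "is_base B \<Longrightarrow> step_l_beta (App (Lam M) B) (subst M B 0)"
  unfolding step_l_beta_eq by (auto intro: ctx_xi_lin.intros rule_beta_v.intros)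

lemma step_l_beta_Al: "rule_Al M N \<Longrightarrow> step_l_beta M N"
  unfolding step_l_beta_eq by (auto intro: ctx_xi_lin.intros)

lemma step_l_beta_L: "rule_L M N \<Longrightarrow> step_l_beta M N"
  unfolding step_l_beta_eq by (auto intro: ctx_xi_lin.intros)

lemma step_l_beta_AppL: "step_l_beta M M' \<Longrightarrow> step_l_beta (App M N) (App M' N)"
  unfolding step_l_beta_eq by (rule ctx_xi_lin.intros)

text \<open>K is kept arbitrary because applications extend it. Being a base term, K can be
  substituted by \<open>rule_beta_v\<close>, and being a value, it lets \<open>rule_Al\<close>
  fire.\<close>

lemma cps_App_reduces_colon:
  fixes M K :: "'a::{ring, monoid_mult} trm"
  assumes "is_base K"
  shows "step_l_beta\<^sup>*\<^sup>* (App (cps M) K) (colon M K)"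
  using assms
proof (induction M arbitrary: K)
  case (Var i)
  show ?case by simp
next
  case (Lam M)
  show ?case
    using step_l_beta_beta_v [OF Lam.prems, of "App (Var 0) (Lam (lift (cps M) 1))"] by auto
next
  case (App M N)
  let ?K = "Lam (App (App (Var 0) (lift (cps N) 0)) (lift K 0))"
  \<comment> \<open>Under g the variable f has index 1, so the outer lift must be read at cutoff 1
    to cancel.\<close>
  have "lift (lift (cps N) 0) 0 = lift (lift (cps N) 0) (Suc 0)"
    by (simp add: lift_lift)
  then have "step_l_beta (App (cps (App M N)) K) (App (cps M) ?K)"
    using step_l_beta_beta_v [OF App.prems,
      of "App (lift (cps M) 0)
            (Lam (App (App (Var 0) (lift (lift (cps N) 0) 0)) (Var 1)))"] by simp
  also have "step_l_beta\<^sup>*\<^sup>* (App (cps M) ?K) (colon M ?K)"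
    by (rule App.IH) (rule is_base.intros)
  finally show ?case by simp
next
  case Zero
  have "step_l_beta\<^sup>*\<^sup>* (App (cps Zero) K) (App Zero K)"
    using step_l_beta_beta_v [OF Zero.prems, of "App Zero (Var 0)"] by auto
  also have "step_l_beta (App Zero K) Zero"
    using Zero by (auto intro: step_l_beta_Al rule_Al.intros is_value.intros)
  finally show ?case by simp
next
  case (Scale \<alpha> M)
  have "step_l_beta\<^sup>*\<^sup>* (App (cps (Scale \<alpha> M)) K) (App (Scale \<alpha> (cps M)) K)"
    using step_l_beta_beta_v [OF Scale.prems, of "App (Scale \<alpha> (lift (cps M) 0)) (Var 0)"] by auto
  also have "step_l_beta (App (Scale \<alpha> (cps M)) K) (Scale \<alpha> (App (cps M) K))"
    using Scale.prems by (auto intro: step_l_beta_Al rule_Al.intros is_value.intros)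
  also have "step_l_beta\<^sup>*\<^sup>* (Scale \<alpha> (App (cps M) K)) (Scale \<alpha> (colon M K))"
    by (intro step_l_beta_rtranclp_Scale Scale)
  finally show ?case by simp
next
  case (Plus M N)
  have "step_l_beta\<^sup>*\<^sup>* (App (cps (Plus M N)) K) (App (Plus (cps M) (cps N)) K)"
    using step_l_beta_beta_v [OF Plus.prems,
      of "App (Plus (lift (cps M) 0) (lift (cps N) 0)) (Var 0)"] by auto
  also have "step_l_beta (App (Plus (cps M) (cps N)) K)
      (Plus (App (cps M) K) (App (cps N) K))"
    using Plus.prems by (auto intro: step_l_beta_Al rule_Al.intros is_value.intros)
  also have "step_l_beta\<^sup>*\<^sup>* (Plus (App (cps M) K) (App (cps N) K))
      (Plus (colon M K) (colon N K))"
    by (intro step_l_beta_rtranclp_Plus Plus)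
  finally show ?case by simp
qed

lemma colon_rule_A: "rule_A M N \<Longrightarrow> colon M K = colon N K"
  by (induction rule: rule_A.induct) auto

text \<open>\<open>colon\<close> commutes with \<open>Zero\<close>, \<open>Scale\<close> and
  \<open>Plus\<close>, so the same rule applies at the root.\<close>

lemma colon_rule_L: "rule_L M N \<Longrightarrow> rule_L (colon M K) (colon N K)"
  unfolding rule_L_def
  by (auto elim!: rule_Asso.cases rule_Com.cases rule_F.cases rule_S.cases
      intro: rule_Asso.intros rule_Com.intros rule_F.intros rule_S.intros)

lemma colon_beta_n:
  fixes M N K :: "'a::{ring, monoid_mult} trm"
  assumes "is_base K"
  shows "step_l_beta\<^sup>*\<^sup>* (colon (App (Lam M) N) K) (colon (subst M N 0) K)"
proof -
  have "step_l_beta\<^sup>*\<^sup>* (colon (App (Lam M) N) K) (App (App (Lam (cps M)) (cps N)) K)"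
    \<comment> \<open>The continuation built for the argument receives \<open>Lam (cps M)\<close> in
      place of g.\<close>
    using step_l_beta_beta_v [of "Lam (cps M)" "App (App (Var 0) (lift (cps N) 0)) (lift K 0)"]
    by (auto simp: is_base.intros)
  also have "step_l_beta (App (App (Lam (cps M)) (cps N)) K)
      (App (cps (subst M N 0)) K)"
    unfolding cps_subst by (intro step_l_beta_AppL step_l_beta_beta_v is_base_cps)
  also have "step_l_beta\<^sup>*\<^sup>* (App (cps (subst M N 0)) K) (colon (subst M N 0) K)"
    using assms by (rule cps_App_reduces_colon)
  finally show ?thesis .
qed

text \<open>\<open>ctx_xi\<close> never reduces an argument, so an \<open>App\<close> context only
  replaces K by a fixed abstraction, again a base term.\<close>

lemma colon_ctx_xi:
  fixes M N K :: "'a::{ring, monoid_mult} trm"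
  assumes "ctx_xi R M N" and "is_base K"
    and "\<And>M N K. R M N \<Longrightarrow> is_base K \<Longrightarrow> step_l_beta\<^sup>*\<^sup>* (colon M K) (colon N K)"
  shows "step_l_beta\<^sup>*\<^sup>* (colon M K) (colon N K)"
  using assms(1,2)
  by (induction arbitrary: K rule: ctx_xi.induct)
    (auto intro: assms(3) step_l_beta_rtranclp_Plus step_l_beta_rtranclp_Scale is_base.intros)

lemma colon_step_a_beta:
  fixes M N K :: "'a::{ring, monoid_mult} trm"
  assumes "step_a_beta M N" and "is_base K"
  shows "step_l_beta\<^sup>*\<^sup>* (colon M K) (colon N K)"
proof -
  consider "ctx_xi (sup rule_A rule_L) M N" | "ctx_xi rule_beta_n M N"
    using assms(1) unfolding step_a_beta_def step_a_def step_beta_n_def by auto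
  then show ?thesis
  proof cases
    case 1
    then show ?thesis using assms(2)
    proof (rule colon_ctx_xi)
      fix M N K :: "'a trm"
      assume "sup rule_A rule_L M N"
      then show "step_l_beta\<^sup>*\<^sup>* (colon M K) (colon N K)"
        by (auto dest: colon_rule_A [of _ _ K] colon_rule_L [of _ _ K] step_l_beta_L)
    qed
  next
    case 2
    then show ?thesis using assms(2)
      by (rule colon_ctx_xi) (metis rule_beta_n.cases colon_beta_n)
  qed
qed

lemma colon_value_reduces_Phi:
  fixes V :: "'a::{ring, monoid_mult} trm"
  assumes "is_value V"
  shows "step_l_beta\<^sup>*\<^sup>* (colon V (Lam (Var 0))) (Phi V)"
  using assms
proof induction
  case (2 B)
  then show ?case
  proof cases
    case (2 M)
    then show ?thesis
      \<comment> \<open>Only abstractions need a step, contracting the identity; on variables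
        \<open>colon\<close> and \<open>Phi\<close> already agree.\<close>
      using step_l_beta_beta_v [of "Lam (cps M)" "Var 0"] by (auto simp: is_base.intros)
  qed simp
qed (auto intro: step_l_beta_rtranclp_Plus step_l_beta_rtranclp_Scale)

theorem theorem8:
  fixes M V :: "'a::{ring, monoid_mult} trm"
  assumes "closed_term M" and "is_value V" and "step_a_beta\<^sup>*\<^sup>* M V"
  shows "step_l_beta\<^sup>*\<^sup>* (App (cps M) (Lam (Var 0))) (Phi V)"
proof -
  have base: "is_base (Lam (Var 0) :: 'a trm)" by (rule is_base.intros)
  then have "step_l_beta\<^sup>*\<^sup>* (App (cps M) (Lam (Var 0))) (colon M (Lam (Var 0)))"
    by (rule cps_App_reduces_colon)
  also from assms(3) have "step_l_beta\<^sup>*\<^sup>* (colon M (Lam (Var 0))) (colon V (Lam (Var 0)))"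
    by induction (auto dest: colon_step_a_beta [OF _ base])
  also have "step_l_beta\<^sup>*\<^sup>* (colon V (Lam (Var 0))) (Phi V)"
    using assms(2) by (rule colon_value_reduces_Phi)
  finally show ?thesis .
qed

end
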